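(* Let $N\ge 2$ be an integer, $a>0$, $b>0$, $m>0$, $h\ge 0$, and let the twisted angle be normalized so that $0\le\theta<2\pi/N$. If the configuration formed by two twisted regular $N$-gons with parameters $(N,a,b,m,h,\theta)$ is a central configuration, then $\theta=0$ or $\theta=\pi/N$. Moreover, if in addition $a=1$ and $h=0$, then $\theta=\pi/N$.
   Context: Identify $\mathbb{R}^3$ with $\mathbb{C}\times\mathbb{R}$. For $1\le k\le N$ let $\theta_k=2k\pi/N$, $\rho_k=e^{i\theta_k}$ and $\tilde\rho_k=a\rho_k e^{i\theta}$. The configuration formed by two twisted regular $N$-gons with parameters $(N,a,b,m,h,\theta)$ consists of $2N$ point masses: a mass $m$ at each point $q_k=(\rho_k,0)$ and a mass $bm$ at each point $\tilde q_k=(\tilde\rho_k,h)$, $1\le k\le N$. Here $h$ is the distance between the two layers and $\theta$ is the twisted angle. By the rotational symmetry of the polygons, $\theta$ matters only modulo $2\pi/N$. Central configuration: point masses $\mu_1,\dots,\mu_n>0$ at positions $x_1,\dots,x_n\in\mathbb{R}^3$ form a central configuration if the positions are pairwise distinct and, with $z_0=\left(\sum_j \mu_j x_j\right)/\left(\sum_j\mu_j\right)$ the center of mass and $y_k=x_k-z_0$, there is $\lambda\in\mathbb{R}$ such that $\sum_{j\ne k}\frac{\mu_j\mu_k}{|y_j-y_k|^3}(y_j-y_k)=-\lambda\mu_k y_k$ for all $1\le k\le n$. *)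

theory Defs
  imports "HOL-Analysis.Analysis"
begin

text \<open>
  Space is \<open>\<real>\<^sup>3\<close> identified with \<open>\<complex> \<times> \<real>\<close>; the product norm of the library is the
  Euclidean one, i.e. the norm of \<open>(z, t)\<close> is the square root of \<open>\<bar>z\<bar>\<^sup>2 + t\<^sup>2\<close>.
\<close>

type_synonym space3 = "complex \<times> real"

definition mass_center :: "'i set \<Rightarrow> ('i \<Rightarrow> real) \<Rightarrow> ('i \<Rightarrow> space3) \<Rightarrow> space3" where
  "mass_center I \<mu> x = (\<Sum>j\<in>I. \<mu> j *\<^sub>R x j) /\<^sub>R (\<Sum>j\<in>I. \<mu> j)"

text \<open>
  The bodies are labelled by a finite set \<open>I\<close> instead of \<open>{1..n}\<close>.  Injectivity of \<open>x\<close> on \<open>I\<close>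
  says that the positions are pairwise distinct.
\<close>

definition central_configuration :: "'i set \<Rightarrow> ('i \<Rightarrow> real) \<Rightarrow> ('i \<Rightarrow> space3) \<Rightarrow> bool" where
  "central_configuration I \<mu> x \<longleftrightarrow>
     finite I \<and> (\<forall>k\<in>I. \<mu> k > 0) \<and> inj_on x I \<and>
     (let y = (\<lambda>k. x k - mass_center I \<mu> x) in
      \<exists>lam::real. \<forall>k\<in>I.
        (\<Sum>j\<in>I - {k}. (\<mu> j * \<mu> k / norm (y j - y k) ^ 3) *\<^sub>R (y j - y k))
          = - (lam * \<mu> k) *\<^sub>R y k)"

definition ngon_vertex :: "nat \<Rightarrow> nat \<Rightarrow> complex" where
  "ngon_vertex N k = cis (2 * real k * pi / real N)"

text \<open>
  Label \<open>Inl k\<close> stands for the body at \<open>q\<^sub>k\<close>, label \<open>Inr k\<close> for the body at the twisted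
  vertex in the layer at height \<open>h\<close>, where \<open>1 \<le> k \<le> N\<close>.
\<close>

definition twisted_ngons_index :: "nat \<Rightarrow> (nat + nat) set" where
  "twisted_ngons_index N = {1..N} <+> {1..N}"

definition twisted_ngons_mass :: "real \<Rightarrow> real \<Rightarrow> nat + nat \<Rightarrow> real" where
  "twisted_ngons_mass b m = case_sum (\<lambda>k. m) (\<lambda>k. b * m)"

definition twisted_ngons_position ::
    "nat \<Rightarrow> real \<Rightarrow> real \<Rightarrow> real \<Rightarrow> nat + nat \<Rightarrow> space3" where
  "twisted_ngons_position N a h \<theta> =
     case_sum (\<lambda>k. (ngon_vertex N k, 0))
              (\<lambda>k. (of_real a * ngon_vertex N k * cis \<theta>, h))"

end

theory Submission
  imports Defs "HOL-Real_Asymp.Real_Asymp"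
begin

text \<open>
  The tangential component of the force on the vertex \<open>1\<close> of the first polygon comes from the
  second polygon only.  It is a positive multiple of
  \<open>\<Sum>\<^sub>k sin \<phi>\<^sub>k / (D - cos \<phi>\<^sub>k)\<^bsup>3/2\<^esup>\<close> with \<open>\<phi>\<^sub>k = \<theta> + 2k\<pi>/N\<close> and
  \<open>D = (1 + a\<^sup>2 + h\<^sup>2)/(2a) \<ge> 1\<close>, and it must vanish.  Since \<open>y\<^bsup>-3/2\<^esup>\<close> is \<open>4/\<pi>\<close> times the
  integral of \<open>(y + t\<^sup>2)\<^bsup>-2\<^esup>\<close> over \<open>t > 0\<close>, the sign of this sum is governed by the sums
  \<open>\<Sum>\<^sub>k sin \<phi>\<^sub>k / (E - cos \<phi>\<^sub>k)\<^sup>2\<close> with \<open>E > 1\<close>.  These are minus the \<open>E\<close>-derivative of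
  \<open>\<Sum>\<^sub>k sin \<phi>\<^sub>k / (E - cos \<phi>\<^sub>k)\<close>, which the substitution \<open>E = (x + 1/x)/2\<close> turns into a
  multiple of the imaginary part of \<open>\<Sum>\<^sub>k 1/(x - exp (i \<phi>\<^sub>k)) = N x\<^bsup>N-1\<^esup>/(x\<^sup>N - exp (i N \<theta>))\<close>;
  so they have the sign of \<open>sin (N \<theta>)\<close>.  Hence \<open>sin (N \<theta>) = 0\<close>.
\<close>

section \<open>Sums over the vertices of a regular polygon\<close>

lemma sum_powers_root_of_unity:
  assumes "0 < n" "n < N"
  shows "(\<Sum>k=1..N. ngon_vertex N k ^ n) = 0"
proof -
  define z where "z = cis (2 * pi * real n / real N)"
  have N: "N > 0" using assms by simp
  have vz: "ngon_vertex N k ^ n = z ^ k" for k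
    unfolding ngon_vertex_def z_def Complex.DeMoivre by (simp add: mult_ac)
  \<comment> \<open>Otherwise \<open>N\<close> would divide \<open>n\<close>, which
    \<open>0 < n < N\<close> excludes; the geometric sum then vanishes.\<close>
  have "z \<noteq> 1"
  proof
    assume "z = 1"
    then have "cos (2 * pi * real n / real N) = 1"
      by (simp add: z_def complex_eq_iff)
    then obtain j :: int where "2 * pi * real n / real N = of_int j * 2 * pi"
      by (auto simp: cos_one_2pi_int)
    then have "real n = of_int j * real N"
      using N by (simp add: field_simps)
    then have "int n = j * int N"
      by (metis of_int_eq_iff of_int_mult of_int_of_nat_eq)
    then have "int N dvd int n" by simp
    then have "N dvd n" by simp
    then show False using assms by (auto dest: dvd_imp_le)
  qed
  moreover have "z ^ N = 1"
    unfolding z_def Complex.DeMoivre using N by (simp add: cis_multiple_2pi)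
  ultimately have "(\<Sum>k<N. z ^ k) = 0"
    by (simp add: geometric_sum)
  moreover have "(\<Sum>k=1..N. z ^ k) = z * (\<Sum>k<N. z ^ k)"
    unfolding sum_distrib_left
    by (rule sum.reindex_bij_witness[where i = Suc and j = "\<lambda>k. k - 1"])
       (auto simp flip: power_Suc)
  ultimately show ?thesis by (simp add: vz)
qed

text \<open>Each w times a vertex is a root of X^N - w^N, so dividing x^N - w^N by the linear factor
  expands each summand into vertex powers of exponent i < N. After swapping the sums only i = 0
  survives.\<close>

lemma sum_inverse_diff_roots:
  fixes x :: complex
  assumes N: "N > 0" and ne: "x ^ N \<noteq> w ^ N"
  shows "(\<Sum>k=1..N. 1 / (x - w * ngon_vertex N k)) = of_nat N * x ^ (N - 1) / (x ^ N - w ^ N)"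
proof -
  have vN: "ngon_vertex N k ^ N = 1" for k
  proof -
    have "real N * (2 * real k * pi / real N) = 2 * pi * real k" using N by simp
    then show ?thesis unfolding ngon_vertex_def Complex.DeMoivre by (simp only: cis_multiple_2pi Ints_of_nat)
  qed
  have "1 / (x - w * ngon_vertex N k)
      = (\<Sum>i<N. x ^ (N - Suc i) * w ^ i * ngon_vertex N k ^ i) / (x ^ N - w ^ N)" for k
  proof -
    define S where "S = (\<Sum>i<N. x ^ (N - Suc i) * w ^ i * ngon_vertex N k ^ i)"
    have "w ^ N - x ^ N = (w * ngon_vertex N k - x) * S"
      using power_diff_sumr2[of "w * ngon_vertex N k" N x]
      by (simp add: S_def power_mult_distrib vN mult_ac)
    then have p: "x ^ N - w ^ N = (x - w * ngon_vertex N k) * S"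
      by (simp add: algebra_simps)
    with ne have "x - w * ngon_vertex N k \<noteq> 0" by auto
    with p ne show ?thesis by (auto simp: S_def[symmetric])
  qed
  then have "(\<Sum>k=1..N. 1 / (x - w * ngon_vertex N k))
      = (\<Sum>k=1..N. \<Sum>i<N. x ^ (N - Suc i) * w ^ i * ngon_vertex N k ^ i) / (x ^ N - w ^ N)"
    by (simp add: sum_divide_distrib)
  also have "(\<Sum>k=1..N. \<Sum>i<N. x ^ (N - Suc i) * w ^ i * ngon_vertex N k ^ i)
      = (\<Sum>i<N. x ^ (N - Suc i) * w ^ i * (\<Sum>k=1..N. ngon_vertex N k ^ i))"
    unfolding sum_distrib_left by (rule sum.swap)
  also have "\<dots> = (\<Sum>i<N. if i = 0 then of_nat N * x ^ (N - 1) else 0)"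
    by (rule sum.cong) (auto simp: sum_powers_root_of_unity[unfolded One_nat_def])
  also have "\<dots> = of_nat N * x ^ (N - 1)"
    using N by simp
  finally show ?thesis .
qed

section \<open>Closed form under the Joukowski substitution\<close>

lemma Im_inverse_diff_cis:
  "Im (1 / (of_real x - cis t)) = sin t / (x\<^sup>2 - 2 * x * cos t + 1)"
proof -
  have "(x - cos t)\<^sup>2 + (sin t)\<^sup>2 = x\<^sup>2 - 2 * x * cos t + 1"
    using sin_cos_squared_add[of t] by (simp add: power2_eq_square algebra_simps)
  then show ?thesis by (simp add: Im_divide)
qed

text \<open>The identity \<open>summand\<close> is used twice: forwards at \<open>x\<close> and each
  angle, and, once the sum over roots has collapsed, backwards at \<open>x ^ N\<close> and the angle
  N \<theta>.\<close>

lemma sum_sin_over_joukowski: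
  fixes x \<theta> :: real
  assumes N: "N > 0" and x: "x > 1"
  defines "\<phi> \<equiv> \<lambda>k. \<theta> + 2 * real k * pi / real N"
  shows "(\<Sum>k=1..N. sin (\<phi> k) / ((x + 1 / x) / 2 - cos (\<phi> k)))
    = real N * sin (real N * \<theta>) / ((x ^ N + 1 / x ^ N) / 2 - cos (real N * \<theta>))"
proof -
  have summand: "sin t / ((y + 1 / y) / 2 - cos t) = 2 * y * Im (1 / (of_real y - cis t))"
    if "y > 1" for y t :: real
  proof -
    have "y\<^sup>2 - 2 * y * cos t + 1 = 2 * y * ((y + 1 / y) / 2 - cos t)"
      using that by (simp add: field_simps power2_eq_square)
    then show ?thesis using that by (simp add: Im_inverse_diff_cis)
  qed
  have Im_scale: "Im (of_real r * u) = r * Im u" for r u by simp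
  have xN: "x ^ N > 1" using N x by (simp add: one_less_power)
  have ne: "(of_real x :: complex) ^ N \<noteq> cis \<theta> ^ N"
  proof
    assume "(of_real x :: complex) ^ N = cis \<theta> ^ N"
    then have "norm ((of_real x :: complex) ^ N) = norm (cis \<theta> ^ N)" by simp
    then show False using x xN by (simp add: norm_power)
  qed
  have phi: "cis (\<phi> k) = cis \<theta> * ngon_vertex N k" for k
    by (simp add: \<phi>_def ngon_vertex_def cis_mult)
  have "(\<Sum>k=1..N. sin (\<phi> k) / ((x + 1 / x) / 2 - cos (\<phi> k)))
      = 2 * x * Im (\<Sum>k=1..N. 1 / (of_real x - cis \<theta> * ngon_vertex N k))"
    using x by (simp only: summand phi[symmetric] sum_distrib_left Im_sum)
  also have "\<dots> = 2 * x * Im (of_real (real N * x ^ (N - 1)) *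
      (1 / (of_real (x ^ N) - cis (real N * \<theta>))))"
    unfolding sum_inverse_diff_roots[OF N ne] Complex.DeMoivre by simp
  also have "\<dots> = real N * (2 * x ^ N * Im (1 / (of_real (x ^ N) - cis (real N * \<theta>))))"
    unfolding Im_scale power_minus_mult[OF N, of x, symmetric] by (simp only: mult_ac)
  also have "\<dots> = real N * sin (real N * \<theta>) / ((x ^ N + 1 / x ^ N) / 2 - cos (real N * \<theta>))"
    by (simp only: summand[OF xN, symmetric] times_divide_eq_right)
  finally show ?thesis .
qed

lemma joukowski_gt_1: "(x + 1 / x) / 2 > 1" if "x > 1" for x :: real
proof -
  have "(x + 1 / x) / 2 - 1 = (x - 1)\<^sup>2 / (2 * x)"
    using that by (simp add: field_simps power2_eq_square)
  moreover have "\<dots> > 0" using that by simp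
  ultimately show ?thesis by linarith
qed

lemma joukowski_surj:
  fixes E :: real
  assumes "E > 1"
  obtains x where "x > 1" "(x + 1 / x) / 2 = E"
proof
  \<comment> \<open>\<open>E + r\<close> and \<open>E - r\<close> are the roots of X^2 - 2 E X + 1;
    their product is 1, so the larger one serves.\<close>
  define r where "r = sqrt (E\<^sup>2 - 1)"
  have r2: "r\<^sup>2 = E\<^sup>2 - 1" and r0: "r \<ge> 0" using assms by (simp_all add: r_def)
  show 1: "E + r > 1" using assms r0 by simp
  have "(E + r) * (E - r) = 1" using r2 by (simp add: algebra_simps power2_eq_square)
  then have "1 / (E + r) = E - r" using 1 by (simp add: field_simps)
  then show "(E + r + 1 / (E + r)) / 2 = E" by simp
qed

section \<open>Signs of the sums with exponents 2 and 3/2\<close>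

text \<open>The closed form is differentiated in x rather than E. The left side gives minus the
  wanted sum times a positive factor; on the right the denominator \<open>P\<close> is positive with
  derivative \<open>Q > 0\<close>, so the derivative has the sign of minus sin (N \<theta>).\<close>

lemma sum_sin_over_square_sign:
  fixes E \<theta> :: real
  assumes N: "N > 0" and E: "E > 1" and s: "sin (real N * \<theta>) \<noteq> 0"
  defines "\<phi> \<equiv> \<lambda>k. \<theta> + 2 * real k * pi / real N"
  shows "sin (real N * \<theta>) * (\<Sum>k=1..N. sin (\<phi> k) / (E - cos (\<phi> k))\<^sup>2) > 0"
proof -
  obtain x where x: "x > 1" and xE: "(x + 1 / x) / 2 = E" using joukowski_surj[OF E] .
  define A where "A = (\<Sum>k=1..N. sin (\<phi> k) / (E - cos (\<phi> k))\<^sup>2)"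
  define s where "s = sin (real N * \<theta>)"
  define P where "P = (x ^ N + 1 / x ^ N) / 2 - cos (real N * \<theta>)"
  define Q where "Q = real N * (x ^ N - 1 / x ^ N) / (2 * x)"
  have xN: "x ^ N > 1" using N x by (simp add: one_less_power)
  have P: "P > 0"
    using joukowski_gt_1[OF xN] cos_le_one[of "real N * \<theta>"] unfolding P_def by linarith
  have "1 / x ^ N < x ^ N" using xN by (simp add: field_simps) (smt (verit) mult_le_cancel_left1)
  then have Q: "Q > 0" using N x by (simp add: Q_def)
  have ne: "(x + 1 / x) / 2 - cos t \<noteq> 0" for t
    using E xE cos_le_one[of t] by linarith
  have "((\<lambda>x. \<Sum>k=1..N. sin (\<phi> k) / ((x + 1 / x) / 2 - cos (\<phi> k))) has_real_derivative
      (\<Sum>k=1..N. - (sin (\<phi> k) / ((x + 1 / x) / 2 - cos (\<phi> k))\<^sup>2) * ((1 - 1 / x\<^sup>2) / 2))) (at x)"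
  proof (rule DERIV_sum)
    fix k
    have "((\<lambda>E. sin (\<phi> k) / (E - cos (\<phi> k))) has_real_derivative
        - (sin (\<phi> k) / ((x + 1 / x) / 2 - cos (\<phi> k))\<^sup>2)) (at ((x + 1 / x) / 2))"
      using ne[of "\<phi> k"] by (auto intro!: derivative_eq_intros simp: power2_eq_square)
    moreover have "((\<lambda>x. (x + 1 / x) / 2) has_real_derivative (1 - 1 / x\<^sup>2) / 2) (at x)"
      using x by (auto intro!: derivative_eq_intros simp: power2_eq_square)
    ultimately show "((\<lambda>x. sin (\<phi> k) / ((x + 1 / x) / 2 - cos (\<phi> k))) has_real_derivative
        - (sin (\<phi> k) / ((x + 1 / x) / 2 - cos (\<phi> k))\<^sup>2) * ((1 - 1 / x\<^sup>2) / 2)) (at x)"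
      by (rule DERIV_chain2)
  qed
  then have d1: "((\<lambda>x. \<Sum>k=1..N. sin (\<phi> k) / ((x + 1 / x) / 2 - cos (\<phi> k)))
      has_real_derivative - A * ((1 - 1 / x\<^sup>2) / 2)) (at x)"
    by (simp only: xE A_def sum_distrib_right[symmetric] sum_negf)
  have dp: "((\<lambda>x. (x ^ N + 1 / x ^ N) / 2 - cos (real N * \<theta>)) has_real_derivative Q) (at x)"
  proof -
    have "x ^ N = x * x ^ (N - 1)" using N by (simp add: power_eq_if)
    then show ?thesis using x unfolding Q_def
      by (auto intro!: derivative_eq_intros simp: field_simps)
  qed
  have d2: "((\<lambda>x. real N * s / ((x ^ N + 1 / x ^ N) / 2 - cos (real N * \<theta>)))
      has_real_derivative - (real N * s * Q / P\<^sup>2)) (at x)"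
    using DERIV_divide[OF DERIV_const dp, of "real N * s"] P by (simp add: P_def power2_eq_square)
  \<comment> \<open>The closed form is known for arguments above 1 only; this set is open, which
    suffices to transfer the derivative.\<close>
  have "((\<lambda>x. \<Sum>k=1..N. sin (\<phi> k) / ((x + 1 / x) / 2 - cos (\<phi> k)))
      has_real_derivative - (real N * s * Q / P\<^sup>2)) (at x)"
    by (rule has_field_derivative_transform_within_open[OF d2, of "{1<..}"])
       (use x N in \<open>auto simp: s_def \<phi>_def sum_sin_over_joukowski[unfolded One_nat_def]\<close>)
  from DERIV_unique[OF d1 this] have "A * ((1 - 1 / x\<^sup>2) / 2) = real N * s * Q / P\<^sup>2"
    by simp
  \<comment> \<open>Multiplying by \<open>s\<close> makes the right side a square times a positive
    number.\<close>
  then have "s * (A * ((1 - 1 / x\<^sup>2) / 2)) = s * (real N * s * Q / P\<^sup>2)" by simp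
  then have "s * A * ((1 - 1 / x\<^sup>2) / 2) = s\<^sup>2 * (real N * Q / P\<^sup>2)"
    by (simp add: power2_eq_square mult_ac)
  moreover have "s\<^sup>2 * (real N * Q / P\<^sup>2) > 0"
    using s P Q N by (simp add: s_def)
  moreover have "(1 - 1 / x\<^sup>2) / 2 > 0" using x by (simp add: one_less_power)
  ultimately have "s * A > 0" by (metis zero_less_mult_pos2)
  then show ?thesis by (simp add: s_def A_def)
qed

text \<open>The integral over t is handled through a primitive \<open>F\<close> with
  \<open>F 0 = 0\<close>, whose limit at infinity is pi / 4 times the product in question. Its
  derivative is positive by the exponent 2 case at E = D + t^2.\<close>

lemma sum_sin_over_three_halves_sign:
  fixes D \<theta> :: real
  assumes N: "N > 0" and D: "D \<ge> 1" and s: "sin (real N * \<theta>) \<noteq> 0"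
  defines "\<phi> \<equiv> \<lambda>k. \<theta> + 2 * real k * pi / real N"
  shows "sin (real N * \<theta>) * (\<Sum>k=1..N. sin (\<phi> k) / sqrt (D - cos (\<phi> k)) ^ 3) > 0"
proof -
  define r where "r k = sqrt (D - cos (\<phi> k))" for k
  define c where "c k = sin (real N * \<theta>) * sin (\<phi> k)" for k
  \<comment> \<open>This keeps the denominators positive when \<open>D = 1\<close>: a vanishing one
    would make N \<theta> a multiple of 2 pi.\<close>
  have "cos (\<phi> k) \<noteq> 1" for k
  proof
    assume "cos (\<phi> k) = 1"
    then obtain n :: int where "\<phi> k = of_int n * 2 * pi"
      by (auto simp: cos_one_2pi_int)
    then have "real N * \<theta> = 2 * pi * of_int (int N * n - int k)"
      using N by (simp add: \<phi>_def field_simps)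
    then show False using s by (simp only: sin_int_2pin)
  qed
  then have "cos (\<phi> k) < D" for k
    using cos_le_one[of "\<phi> k"] D by (smt (verit))
  then have r: "r k > 0" and r2: "(r k)\<^sup>2 = D - cos (\<phi> k)" for k
    by (simp_all add: r_def less_imp_le)
  \<comment> \<open>\<open>g k\<close> is the primitive of \<open>t \<mapsto> (r\<^sub>k\<^sup>2 + t\<^sup>2)\<^bsup>-2\<^esup>\<close> that vanishes at \<open>0\<close>; its limit
    at infinity is \<open>\<pi> / (4 r\<^sub>k\<^sup>3)\<close>.\<close>
  define g where "g k t = t / ((r k)\<^sup>2 + t\<^sup>2) / (2 * (r k)\<^sup>2) + arctan (t / r k) / (2 * r k ^ 3)"
    for k t
  define F where "F t = (\<Sum>k=1..N. c k * g k t)" for t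
  have dg: "(g k has_real_derivative 1 / ((r k)\<^sup>2 + t\<^sup>2)\<^sup>2) (at t)" for k t
  proof -
    have p: "(r k)\<^sup>2 + t\<^sup>2 > 0" using r[of k] by (simp add: pos_add_strict add_pos_nonneg)
    have q: "1 + (t / r k)\<^sup>2 = ((r k)\<^sup>2 + t\<^sup>2) / (r k)\<^sup>2"
      using r[of k] by (simp add: field_simps)
    define u where "u = (r k)\<^sup>2 + t\<^sup>2"
    have "((\<lambda>t. t / ((r k)\<^sup>2 + t\<^sup>2)) has_real_derivative (u - t * (2 * t)) / u\<^sup>2) (at t)"
      using p by (auto intro!: derivative_eq_intros simp: u_def power2_eq_square)
    moreover have "((\<lambda>t. arctan (t / r k)) has_real_derivative (1 / r k) / (1 + (t / r k)\<^sup>2)) (at t)"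
      using r[of k] by (auto intro!: derivative_eq_intros simp: divide_inverse)
    ultimately have "(g k has_real_derivative
        (u - t * (2 * t)) / u\<^sup>2 / (2 * (r k)\<^sup>2) + (1 / r k) / (1 + (t / r k)\<^sup>2) / (2 * r k ^ 3)) (at t)"
      unfolding g_def[abs_def] by (intro DERIV_add DERIV_cdivide)
    also have "(u - t * (2 * t)) / u\<^sup>2 / (2 * (r k)\<^sup>2) + (1 / r k) / (1 + (t / r k)\<^sup>2) / (2 * r k ^ 3)
        = ((u - 2 * t\<^sup>2) + u) / (2 * (r k)\<^sup>2 * u\<^sup>2)"
      using r[of k] p unfolding q u_def[symmetric]
      by (simp add: field_simps power2_eq_square power3_eq_cube)
    also have "(u - 2 * t\<^sup>2) + u = 2 * (r k)\<^sup>2" by (simp add: u_def)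
    finally show ?thesis using r[of k] by (simp add: u_def)
  qed
  have dF: "(F has_real_derivative (\<Sum>k=1..N. c k * (1 / ((r k)\<^sup>2 + t\<^sup>2)\<^sup>2))) (at t)" for t
    unfolding F_def[abs_def] by (intro DERIV_sum DERIV_cmult dg)
  \<comment> \<open>For \<open>D = 1\<close> the bound D + t^2 > 1 fails at t = 0, hence the
    restriction to \<open>t > 0\<close>.\<close>
  have pos: "(\<Sum>k=1..N. c k * (1 / ((r k)\<^sup>2 + t\<^sup>2)\<^sup>2)) > 0" if "t > 0" for t
  proof -
    have "D + t\<^sup>2 > 1" using D that by (simp add: add_le_less_mono[of 1 D 0, simplified])
    from sum_sin_over_square_sign[OF N this s] show ?thesis
      by (simp add: r2 c_def \<phi>_def sum_distrib_left algebra_simps)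
  qed
  have contF: "continuous_on S F" for S
    by (rule DERIV_continuous_on[OF has_field_derivative_at_within[OF dF]])
  \<comment> \<open>Limits preserve only weak inequalities, so strictness is secured at 1: the limit
    is at least \<open>F 1 > 0\<close>.\<close>
  have "F 0 < F 1"
  proof (rule DERIV_pos_imp_increasing_open[of 0 1 F])
    fix u :: real assume "0 < u"
    then show "\<exists>y. (F has_real_derivative y) (at u) \<and> y > 0" using dF[of u] pos[of u] by blast
  qed (use contF in auto)
  then have F1: "F 1 > 0" by (simp add: F_def g_def)
  have mono: "F 1 \<le> F t" if "t \<ge> 1" for t
  proof (rule DERIV_nonneg_imp_nondecreasing[of 1 t F, OF that])
    fix u :: real assume "1 \<le> u"
    then have "u > 0" by simp
    then show "\<exists>y. (F has_real_derivative y) (at u) \<and> y \<ge> 0"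
      using dF[of u] pos[of u] less_imp_le by blast
  qed
  have limg: "(g k \<longlongrightarrow> pi / (4 * r k ^ 3)) at_top" for k
  proof -
    have "((\<lambda>t::real. t / (q + t\<^sup>2)) \<longlongrightarrow> 0) at_top" for q :: real
      by real_asymp
    from tendsto_divide_zero[OF this]
    have "((\<lambda>t. t / ((r k)\<^sup>2 + t\<^sup>2) / (2 * (r k)\<^sup>2)) \<longlongrightarrow> 0) at_top" .
    moreover have "((\<lambda>t. arctan (t / r k) / (2 * r k ^ 3)) \<longlongrightarrow> (pi / 2) / (2 * r k ^ 3)) at_top"
    proof (rule tendsto_divide[OF filterlim_compose[OF tendsto_arctan_at_top] tendsto_const])
      show "filterlim (\<lambda>t. t / r k) at_top at_top" using r[of k] by real_asymp
    qed (use r[of k] in simp)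
    ultimately have "(g k \<longlongrightarrow> 0 + (pi / 2) / (2 * r k ^ 3)) at_top"
      unfolding g_def[abs_def] by (rule tendsto_add)
    then show ?thesis by simp
  qed
  have "(F \<longlongrightarrow> (\<Sum>k=1..N. c k * (pi / (4 * r k ^ 3)))) at_top"
    unfolding F_def[abs_def] by (intro tendsto_sum tendsto_mult tendsto_const limg)
  then have "F 1 \<le> (\<Sum>k=1..N. c k * (pi / (4 * r k ^ 3)))"
  proof (rule tendsto_lowerbound)
    show "\<forall>\<^sub>F t in at_top. F 1 \<le> F t" using mono by (rule eventually_at_top_linorderI)
  qed simp
  also have "\<dots> = pi / 4 * (sin (real N * \<theta>) * (\<Sum>k=1..N. sin (\<phi> k) / r k ^ 3))"
    by (simp add: c_def sum_distrib_left mult_ac)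
  finally have "pi / 4 * (sin (real N * \<theta>) * (\<Sum>k=1..N. sin (\<phi> k) / r k ^ 3)) > 0"
    using F1 by linarith
  then show ?thesis unfolding r_def by (rule zero_less_mult_pos) simp
qed

section \<open>Force balance and the twisted angle\<close>

lemma ngon_vertex_reflect:
  assumes "k \<le> N" "N > 0"
  shows "ngon_vertex N (N - k) = cnj (ngon_vertex N k)"
proof -
  have "2 * real (N - k) * pi / real N = 2 * pi - 2 * real k * pi / real N"
    using assms by (simp add: of_nat_diff field_simps)
  then show ?thesis by (simp add: ngon_vertex_def complex_eq_iff cos_diff sin_diff)
qed

text \<open>Reflection k -> N - k conjugates the vertices: it keeps distances to 1 and negates
  imaginary parts, so the terms cancel.\<close>

lemma ngon_self_force_radial:
  assumes N: "N > 0"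
  shows "(\<Sum>k=1..N. Im (ngon_vertex N k) / norm (ngon_vertex N k - 1) ^ 3) = 0"
proof -
  define f where "f k = Im (ngon_vertex N k) / norm (ngon_vertex N k - 1) ^ 3" for k
  have "f (N - k) = - f k" if "k \<le> N" for k
  proof -
    have "norm (cnj (ngon_vertex N k) - 1) = norm (ngon_vertex N k - 1)"
      by (metis complex_cnj_diff complex_cnj_one complex_mod_cnj)
    then show ?thesis by (simp add: f_def ngon_vertex_reflect[OF that N])
  qed
  moreover have "(\<Sum>k=1..<N. f k) = (\<Sum>k=1..<N. f (N - k))"
    by (rule sum.reindex_bij_witness[where i = "\<lambda>k. N - k" and j = "\<lambda>k. N - k"]) auto
  ultimately have "(\<Sum>k=1..<N. f k) = (\<Sum>k=1..<N. - f k)" by simp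
  then have "(\<Sum>k=1..<N. f k) = 0" by (simp add: sum_negf)
  \<comment> \<open>The vertex's own term is 0 / 0, which is 0 by convention and so may stay in the
    sum.\<close>
  moreover have "f N = 0" using N by (simp add: f_def ngon_vertex_def)
  moreover have "{1..N} = insert N {1..<N}" using N by auto
  ultimately show ?thesis by (simp add: f_def)
qed

text \<open>The body \<open>Inl N\<close> sits at \<open>(1, 0)\<close>, where the imaginary
  direction is tangential. The center of mass lies on the axis, so the right side of its equation
  has no such component; the pull of its own polygon has none either, leaving only the second
  polygon.\<close>

lemma central_configuration_tangential:
  fixes N :: nat and a b m h \<theta> :: real
  assumes N: "N \<ge> 2"
    and cc: "central_configuration (twisted_ngons_index N) (twisted_ngons_mass b m)
           (twisted_ngons_position N a h \<theta>)"
  shows "(\<Sum>k=1..N. b * m * m / norm (of_real a * ngon_vertex N k * cis \<theta> - 1, h) ^ 3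
           * (a * sin (\<theta> + 2 * real k * pi / real N))) = 0"
proof -
  define I where "I = twisted_ngons_index N"
  define \<mu> where "\<mu> = twisted_ngons_mass b m"
  define x where "x = twisted_ngons_position N a h \<theta>"
  define z where "z = mass_center I \<mu> x"
  define p where "p = (Inl N :: nat + nat)"
  define T where "T j = \<mu> j * \<mu> p / norm (x j - x p) ^ 3 * Im (fst (x j - x p))" for j
  have I: "I = {1..N} <+> {1..N}" by (simp add: I_def twisted_ngons_index_def)
  have fin: "finite I" by (simp add: I)
  have pI: "p \<in> I" using N by (auto simp: I p_def Plus_def)
  have vN: "ngon_vertex N N = 1" using N by (simp add: ngon_vertex_def)
  then have xp: "x p = (1, 0)" by (simp add: x_def p_def twisted_ngons_position_def)
  \<comment> \<open>Here \<open>N \<ge> 2\<close> enters, as the exponent 1 must be below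
    \<open>N\<close>.\<close>
  have v0: "(\<Sum>k=1..N. ngon_vertex N k) = 0"
    using sum_powers_root_of_unity[of 1 N] N by simp
  have "fst (\<Sum>j\<in>I. \<mu> j *\<^sub>R x j) = of_real m * (\<Sum>k=1..N. ngon_vertex N k)
      + of_real (b * m * a) * cis \<theta> * (\<Sum>k=1..N. ngon_vertex N k)"
    unfolding fst_sum I sum.Plus[OF finite_atLeastAtMost finite_atLeastAtMost] sum_distrib_left
    by (simp add: \<mu>_def x_def twisted_ngons_mass_def twisted_ngons_position_def
        scaleR_conv_of_real fst_sum mult_ac)
  then have "fst (\<Sum>j\<in>I. \<mu> j *\<^sub>R x j) = 0" unfolding v0 by simp
  then have z: "fst z = 0" by (simp add: z_def mass_center_def)
  obtain lam where "(\<Sum>j\<in>I - {p}. (\<mu> j * \<mu> p / norm (x j - z - (x p - z)) ^ 3) *\<^sub>R (x j - z - (x p - z)))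
      = - (lam * \<mu> p) *\<^sub>R (x p - z)"
    using cc pI unfolding central_configuration_def Let_def I_def \<mu>_def x_def z_def by blast
  then have "Im (fst (\<Sum>j\<in>I - {p}. (\<mu> j * \<mu> p / norm (x j - x p) ^ 3) *\<^sub>R (x j - x p))) = 0"
    by (simp add: xp z)
  then have "(\<Sum>j\<in>I - {p}. T j) = 0"
    by (simp add: T_def fst_sum Im_sum)
  \<comment> \<open>The restored term \<open>T p\<close> is zero because its displacement is; the
    sum then splits into two full polygons.\<close>
  then have "(\<Sum>j\<in>I. T j) = 0"
    using fin pI by (simp add: sum.remove[of I p] T_def)
  then have "(\<Sum>k=1..N. T (Inl k)) + (\<Sum>k=1..N. T (Inr k)) = 0"
    by (simp add: I sum.Plus o_def)
  moreover have "(\<Sum>k=1..N. T (Inl k)) = m * m * (\<Sum>k=1..N. Im (ngon_vertex N k) / norm (ngon_vertex N k - 1) ^ 3)"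
    unfolding sum_distrib_left
    by (simp add: T_def \<mu>_def p_def twisted_ngons_mass_def x_def twisted_ngons_position_def
        norm_Pair vN)
  moreover have "T (Inr k) = b * m * m / norm (of_real a * ngon_vertex N k * cis \<theta> - 1, h) ^ 3
           * (a * sin (\<theta> + 2 * real k * pi / real N))" for k
  proof -
    have "ngon_vertex N k * cis \<theta> = cis (\<theta> + 2 * real k * pi / real N)"
      by (simp add: ngon_vertex_def cis_mult add.commute)
    then have "Im (of_real a * ngon_vertex N k * cis \<theta>) = a * sin (\<theta> + 2 * real k * pi / real N)"
      by (simp add: mult.assoc)
    then show ?thesis
      unfolding T_def xp
      by (simp add: \<mu>_def p_def twisted_ngons_mass_def x_def twisted_ngons_position_def)
  qed
  ultimately show ?thesis
    using ngon_self_force_radial[of N] N by simp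
qed

theorem theorem1p8:
  fixes N :: nat and a b m h \<theta> :: real
  assumes "N \<ge> 2" and "a > 0" and "b > 0" and "m > 0" and "h \<ge> 0"
    and "0 \<le> \<theta>" and "\<theta> < 2 * pi / real N"
    and "central_configuration (twisted_ngons_index N) (twisted_ngons_mass b m)
           (twisted_ngons_position N a h \<theta>)"
  shows "(\<theta> = 0 \<or> \<theta> = pi / real N) \<and> (a = 1 \<and> h = 0 \<longrightarrow> \<theta> = pi / real N)"
proof -
  define D where "D = (1 + a\<^sup>2 + h\<^sup>2) / (2 * a)"
  define \<phi> where "\<phi> k = \<theta> + 2 * real k * pi / real N" for k
  have N: "N > 0" using assms by simp
  have "1 + a\<^sup>2 + h\<^sup>2 - 2 * a = (a - 1)\<^sup>2 + h\<^sup>2" by (simp add: power2_eq_square algebra_simps)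
  then have "1 + a\<^sup>2 + h\<^sup>2 \<ge> 2 * a" by (smt (verit) zero_le_power2)
  then have D: "D \<ge> 1" using assms by (simp add: D_def)
  \<comment> \<open>By the law of cosines the squared distance is 1 + a^2 + h^2 - 2 a cos (\<phi>
    k); the factor 2 a common to all k splits off.\<close>
  have dist: "norm (of_real a * ngon_vertex N k * cis \<theta> - 1, h) = sqrt (2 * a) * sqrt (D - cos (\<phi> k))" for k
  proof -
    have "ngon_vertex N k * cis \<theta> = cis (\<phi> k)"
      by (simp add: ngon_vertex_def cis_mult \<phi>_def add.commute)
    then have "(norm (of_real a * ngon_vertex N k * cis \<theta> - 1))\<^sup>2 = (a * cos (\<phi> k) - 1)\<^sup>2 + (a * sin (\<phi> k))\<^sup>2"
      by (simp add: mult.assoc cmod_power2)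
    also have "\<dots> = a\<^sup>2 * ((sin (\<phi> k))\<^sup>2 + (cos (\<phi> k))\<^sup>2) + 1 - 2 * a * cos (\<phi> k)"
      by algebra
    also have "\<dots> = a\<^sup>2 + 1 - 2 * a * cos (\<phi> k)" by simp
    also have "\<dots> = 2 * a * (D - cos (\<phi> k)) - h\<^sup>2"
      using assms by (simp add: D_def field_simps)
    finally show ?thesis by (simp add: norm_Pair flip: real_sqrt_mult)
  qed
  have "a * b * m * m / sqrt (2 * a) ^ 3 * (\<Sum>k=1..N. sin (\<phi> k) / sqrt (D - cos (\<phi> k)) ^ 3) = 0"
    using central_configuration_tangential[OF assms(1,8)]
    unfolding dist sum_distrib_left by (simp add: \<phi>_def power_mult_distrib mult_ac)
  moreover have "a * b * m * m / sqrt (2 * a) ^ 3 \<noteq> 0" using assms by simp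
  ultimately have "(\<Sum>k=1..N. sin (\<phi> k) / sqrt (D - cos (\<phi> k)) ^ 3) = 0"
    by (metis mult_eq_0_iff)
  then have sin0: "sin (real N * \<theta>) = 0"
    using sum_sin_over_three_halves_sign[OF N D, of \<theta>] unfolding \<phi>_def by fastforce
  \<comment> \<open>The normalization of \<theta> places N \<theta> in [0, 2 pi), where sine
    vanishes only at 0 and pi.\<close>
  have "0 \<le> real N * \<theta>" "real N * \<theta> < 2 * pi"
    using assms N by (simp_all add: field_simps)
  then have "real N * \<theta> = 0 \<or> real N * \<theta> = pi"
    using sin0 sin_gt_zero[of "real N * \<theta>"] sin_lt_zero[of "real N * \<theta>"] by linarith
  then have "\<theta> = 0 \<or> \<theta> = pi / real N" using N by (auto simp: field_simps)
  \<comment> \<open>Untwisted polygons of equal size in one plane coincide, against distinctness of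
    the positions.\<close>
  moreover have "\<theta> \<noteq> 0" if "a = 1" "h = 0"
  proof
    assume "\<theta> = 0"
    then have "twisted_ngons_position N a h \<theta> (Inl N) = twisted_ngons_position N a h \<theta> (Inr N)"
      using that by (simp add: twisted_ngons_position_def)
    moreover have "inj_on (twisted_ngons_position N a h \<theta>) (twisted_ngons_index N)"
      using assms(8) by (simp add: central_configuration_def)
    moreover have "Inl N \<in> twisted_ngons_index N" "Inr N \<in> twisted_ngons_index N"
      using N by (auto simp: twisted_ngons_index_def)
    ultimately show False by (auto dest: inj_onD)
  qed
  ultimately show ?thesis by blast
qed

end
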